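(* Let $d\ge 1$ and let $\Delta = \Delta(\mathcal{X})$ be the EM simplex on a family $\mathcal{X}=(X_0,\ldots,X_d)$ of finite sets. Then \[ {\rm Vol}(\Delta) = \frac{1}{d}\left( {\rm SA}(\Delta) + \frac{d+1}{2}\cdot |{\rm Med}(\mathcal{X})| \right), \] where ${\rm SA}(\Delta) = \sum_{i=0}^d {\rm Vol}(\{X_0,\ldots,\widehat{X_i},\ldots,X_d\})$ is the sum of the volumes of the $d+1$ facets of $\Delta$.
   Context: Let $d \geq 0$ and $\mathcal{X} = (X_0, \ldots, X_d)$ a family of finite sets (repetitions allowed; vertices are indexed by $0,\dots,d$). Write $\cup\mathcal{X} = \bigcup_i X_i$ and, for $x \in \cup\mathcal{X}$, $\deg_{\mathcal{X}}(x) = \#\{i : x \in X_i\}$. Let ${\rm Min}(\mathcal{X}), {\rm Med}(\mathcal{X}), {\rm Maj}(\mathcal{X})$ be the sets of $x\in\cup\mathcal{X}$ with $\deg_{\mathcal{X}}(x) <, =, > (d+1)/2$ respectively. The abstract $d$-simplex $\Delta(\mathcal{X})$ has as faces all subsets $\mathcal{F}$ of the vertex set $\{X_0,\dots,X_d\}$ (including $\varnothing$), with $\dim\mathcal{F} = \#\mathcal{F}-1$; a cofacet of $\mathcal{F}$ is a face $\mathcal{G}\supset\mathcal{F}$ with $\#\mathcal{G}=\#\mathcal{F}+1$. Define $\epsilon(x) = \{X_i : x \in X_i\}$ if $x \in {\rm Min}(\mathcal{X})\cup{\rm Med}(\mathcal{X})$ and $\epsilon(x) = \{X_i : x \notin X_i\}$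 if $x\in{\rm Maj}(\mathcal{X})$. Define labelings: for faces with $\dim \mathcal{F}\le\lfloor(d-1)/2\rfloor$, $\lambda^{(0)}(\mathcal{F}) = \{x : \epsilon(x) = \mathcal{F}\}$; for faces with $\dim\mathcal{F} \le \lfloor (d-1)/2\rfloor - (i+1)$, $\lambda^{(i+1)}(\mathcal{F})$ is the multiset union of $\lambda^{(i)}(\mathcal{G})$ over all cofacets $\mathcal{G}$ of $\mathcal{F}$. The EM simplex is $\Delta(\mathcal{X})$ with these labelings. ${\rm Vol}_i(\Delta) = \sum_{\mathcal{F}} |\lambda^{(i)}(\mathcal{F})|$ (multiset cardinalities) over faces with $\dim\mathcal{F}\le\lfloor(d-1)/2\rfloor - i$, and ${\rm Vol}(\Delta) = {\rm Vol}_1(\Delta)$. For a face $\mathcal{F}$, ${\rm Vol}(\mathcal{F})$ is the volume of the EM simplex on the subfamily $\mathcal{F}$ (of dimension $\dim\mathcal{F}$). *)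

theory Defs
  imports Complex_Main "HOL-Library.Multiset"
begin

text \<open>
  A family of sets is given by a finite index set \<open>I\<close> and a map \<open>X\<close>; the family
  \<open>(X\<^sub>0, \<dots>, X\<^sub>d)\<close> has \<open>I = {0..d}\<close>. Vertices and faces of the simplex are represented by
  indices and sets of indices, so that repeated members of the family remain distinct vertices.
  The subfamily determined by a face \<open>F\<close> is \<open>X\<close> over the index set \<open>F\<close>, so all notions below
  apply to it without reindexing.
\<close>

definition fdim :: "'i set \<Rightarrow> int" where
  "fdim F = int (card F) - 1"

definition family_union :: "'i set \<Rightarrow> ('i \<Rightarrow> 'a set) \<Rightarrow> 'a set" where
  "family_union I X = (\<Union>i\<in>I. X i)"

definition fdeg :: "'i set \<Rightarrow> ('i \<Rightarrow> 'a set) \<Rightarrow> 'a \<Rightarrow> nat" where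
  "fdeg I X x = card {i \<in> I. x \<in> X i}"

definition EM_Min :: "'i set \<Rightarrow> ('i \<Rightarrow> 'a set) \<Rightarrow> 'a set" where
  "EM_Min I X = {x \<in> family_union I X. real (fdeg I X x) < (real_of_int (fdim I) + 1) / 2}"

definition EM_Med :: "'i set \<Rightarrow> ('i \<Rightarrow> 'a set) \<Rightarrow> 'a set" where
  "EM_Med I X = {x \<in> family_union I X. real (fdeg I X x) = (real_of_int (fdim I) + 1) / 2}"

definition EM_Maj :: "'i set \<Rightarrow> ('i \<Rightarrow> 'a set) \<Rightarrow> 'a set" where
  "EM_Maj I X = {x \<in> family_union I X. real (fdeg I X x) > (real_of_int (fdim I) + 1) / 2}"

definition faces :: "'i set \<Rightarrow> 'i set set" where
  "faces I = Pow I"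

definition cofacets :: "'i set \<Rightarrow> 'i set \<Rightarrow> 'i set set" where
  "cofacets I F = {G \<in> faces I. F \<subseteq> G \<and> card G = card F + 1}"

text \<open>Only the values of \<open>EM_eps\<close> at points of \<open>family_union I X\<close> are meaningful; there the second
  branch is the case \<open>x \<in> EM_Maj I X\<close>.\<close>

definition EM_eps :: "'i set \<Rightarrow> ('i \<Rightarrow> 'a set) \<Rightarrow> 'a \<Rightarrow> 'i set" where
  "EM_eps I X x =
     (if x \<in> EM_Min I X \<union> EM_Med I X then {i \<in> I. x \<in> X i} else {i \<in> I. x \<notin> X i})"

definition label_bound :: "'i set \<Rightarrow> nat \<Rightarrow> int" where
  "label_bound I k = \<lfloor>(real_of_int (fdim I) - 1) / 2\<rfloor> - int k"

text \<open>
  The \<open>k\<close>-th labeling is meant only for faces of dimension at most \<open>label_bound I k\<close>. It is a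
  total function here, but no value outside that range is used: a cofacet of a face of dimension
  at most \<open>label_bound I (Suc k)\<close> has dimension at most \<open>label_bound I k\<close>.
  The multiset union is the additive one.
\<close>

primrec EM_label :: "'i set \<Rightarrow> ('i \<Rightarrow> 'a set) \<Rightarrow> nat \<Rightarrow> 'i set \<Rightarrow> 'a multiset" where
  "EM_label I X 0 F = mset_set {x \<in> family_union I X. EM_eps I X x = F}"
| "EM_label I X (Suc k) F = (\<Sum>G\<in>cofacets I F. EM_label I X k G)"

definition EM_Vol_at :: "nat \<Rightarrow> 'i set \<Rightarrow> ('i \<Rightarrow> 'a set) \<Rightarrow> nat" where
  "EM_Vol_at k I X = (\<Sum>F | F \<in> faces I \<and> fdim F \<le> label_bound I k. size (EM_label I X k F))"

definition EM_Vol :: "'i set \<Rightarrow> ('i \<Rightarrow> 'a set) \<Rightarrow> nat" where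
  "EM_Vol I X = EM_Vol_at 1 I X"

definition EM_SA :: "'i set \<Rightarrow> ('i \<Rightarrow> 'a set) \<Rightarrow> nat" where
  "EM_SA I X = (\<Sum>i\<in>I. EM_Vol (I - {i}) X)"

end

theory Submission
  imports Defs
begin

text \<open>
  A point of degree \<open>k\<close> in a family of \<open>n\<close> sets has \<open>\<bar>\<epsilon>(x)\<bar> = min k (n - k)\<close>, and it is counted
  in the volume once for each facet of \<open>\<epsilon>(x)\<close>. Hence the volume is \<open>\<Sum>x. min k (n - k)\<close>. Deleting
  a member \<open>X i\<close> lowers \<open>n\<close> by one, and lowers \<open>k\<close> by one precisely when \<open>x \<in> X i\<close>, so \<open>x\<close> contributes
  \<open>k * min (k - 1) (n - k) + (n - k) * min k (n - 1 - k)\<close> to the surface area. This equals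
  \<open>(n - 1) * min k (n - k)\<close>, except that it falls short by \<open>k = n / 2\<close> at the median points.
\<close>

lemma fdeg_le_card: "finite I \<Longrightarrow> fdeg I X x \<le> card I"
  unfolding fdeg_def by (rule card_mono) auto

lemma fdeg_eq_0: "x \<notin> family_union I X \<Longrightarrow> fdeg I X x = 0"
  by (auto simp: fdeg_def family_union_def card_eq_0_iff)

lemma fdeg_remove:
  assumes "finite I" "i \<in> I"
  shows "fdeg (I - {i}) X x = (if x \<in> X i then fdeg I X x - 1 else fdeg I X x)"
proof -
  have "{j \<in> I - {i}. x \<in> X j} = {j \<in> I. x \<in> X j} - {i}" by auto
  then show ?thesis using assms by (simp add: fdeg_def card_Diff_singleton_if)
qed

lemma card_not_mem:
  assumes "finite I"
  shows "card {i \<in> I. x \<notin> X i} = card I - fdeg I X x"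
proof -
  have "{i \<in> I. x \<notin> X i} = I - {i \<in> I. x \<in> X i}" by auto
  then show ?thesis using assms by (simp add: fdeg_def card_Diff_subset)
qed

lemma EM_Med_iff: "x \<in> EM_Med I X \<longleftrightarrow> x \<in> family_union I X \<and> 2 * fdeg I X x = card I"
  by (auto simp: EM_Med_def fdim_def field_simps)

lemma EM_Min_iff: "x \<in> EM_Min I X \<longleftrightarrow> x \<in> family_union I X \<and> 2 * fdeg I X x < card I"
  by (auto simp: EM_Min_def fdim_def field_simps)

lemma EM_eps_subset: "EM_eps I X x \<subseteq> I"
  by (auto simp: EM_eps_def)

lemma card_EM_eps:
  assumes "finite I" "x \<in> family_union I X"
  shows "card (EM_eps I X x) = min (fdeg I X x) (card I - fdeg I X x)"
proof (cases "2 * fdeg I X x \<le> card I")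
  case True
  then have "EM_eps I X x = {i \<in> I. x \<in> X i}"
    using assms(2) by (auto simp: EM_eps_def EM_Med_iff EM_Min_iff)
  then show ?thesis using True by (simp add: fdeg_def[symmetric])
next
  case False
  then have "EM_eps I X x = {i \<in> I. x \<notin> X i}"
    by (auto simp: EM_eps_def EM_Med_iff EM_Min_iff)
  then show ?thesis using False by (simp add: card_not_mem[OF assms(1)])
qed

text \<open>The floor drops out because \<open>fdim F + 1\<close> is an integer. What remains is met
  by every facet of a set containing at most half of the vertices.\<close>

lemma label_bound_one_iff: "fdim F \<le> label_bound I 1 \<longleftrightarrow> 2 * card F + 2 \<le> card I"
proof -
  have "fdim F \<le> label_bound I 1 \<longleftrightarrow> fdim F + 1 \<le> \<lfloor>(real_of_int (fdim I) - 1) / 2\<rfloor>"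
    by (auto simp: label_bound_def)
  also have "\<dots> \<longleftrightarrow> real (card F) \<le> (real (card I) - 2) / 2"
    by (simp add: le_floor_iff fdim_def)
  also have "\<dots> \<longleftrightarrow> real (2 * card F + 2) \<le> real (card I)"
    by (simp add: field_simps)
  finally show ?thesis by (simp only: of_nat_le_iff)
qed

lemma card_subsets_one_smaller:
  assumes "finite A"
  shows "card {B. B \<subseteq> A \<and> card A = card B + 1} = card A"
\<comment> \<open>For \<open>card A = Suc m\<close> the count is the binomial coefficient of
  \<open>Suc m\<close> over \<open>m\<close>; for empty \<open>A\<close> the condition
  \<open>0 = card B + 1\<close> has no solution.\<close>
proof (cases "card A")
  case (Suc m)
  then have "{B. B \<subseteq> A \<and> card A = card B + 1} = {B. B \<subseteq> A \<and> card B = m}" by auto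
  then show ?thesis using n_subsets[OF assms, of m] Suc by simp
qed auto

lemma finite_cofacets: "finite I \<Longrightarrow> finite (cofacets I F)"
  by (rule finite_subset[of _ "Pow I"]) (auto simp: cofacets_def faces_def)

lemma card_faces_with_cofacet_eps:
  assumes "finite I" "x \<in> family_union I X"
  shows "card {F \<in> faces I. fdim F \<le> label_bound I 1 \<and> EM_eps I X x \<in> cofacets I F}
    = card (EM_eps I X x)"
proof -
  let ?E = "EM_eps I X x"
  \<comment> \<open>This makes the dimension bound automatic for the facets of
    \<open>?E\<close>.\<close>
  have "2 * card ?E \<le> card I"
    unfolding card_EM_eps[OF assms] by linarith
  then have "{F \<in> faces I. fdim F \<le> label_bound I 1 \<and> ?E \<in> cofacets I F}
      = {F. F \<subseteq> ?E \<and> card ?E = card F + 1}"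
    unfolding label_bound_one_iff using EM_eps_subset[of I X x]
    by (auto simp: cofacets_def faces_def)
  moreover have "finite ?E" using EM_eps_subset assms(1) by (rule finite_subset)
  ultimately show ?thesis using card_subsets_one_smaller by simp
qed

lemma EM_Vol_eq_sum:
  assumes I: "finite I" and X: "\<And>i. i \<in> I \<Longrightarrow> finite (X i)"
  shows "EM_Vol I X = (\<Sum>x\<in>family_union I X. min (fdeg I X x) (card I - fdeg I X x))"
proof -
  let ?U = "family_union I X"
  let ?A = "{F \<in> faces I. fdim F \<le> label_bound I 1}"
  have U: "finite ?U" using I X by (auto simp: family_union_def)
  have A: "finite ?A" using I by (simp add: faces_def)
  \<comment> \<open>Label sizes become sums of indicators, so that the sum over points can be moved
    outermost.\<close>
  have "EM_Vol I X = (\<Sum>F\<in>?A. \<Sum>G\<in>cofacets I F. \<Sum>x\<in>?U. of_bool (EM_eps I X x = G))"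
    using U by (simp add: EM_Vol_def EM_Vol_at_def Int_def)
  also have "\<dots> = (\<Sum>F\<in>?A. \<Sum>x\<in>?U. \<Sum>G\<in>cofacets I F. of_bool (EM_eps I X x = G))"
    by (intro sum.cong refl sum.swap)
  also have "\<dots> = (\<Sum>x\<in>?U. \<Sum>F\<in>?A. \<Sum>G\<in>cofacets I F. of_bool (EM_eps I X x = G))"
    by (rule sum.swap)
  \<comment> \<open>At most one \<open>G\<close> equals \<open>EM_eps I X x\<close>, so the sum over
    cofacets is a membership test.\<close>
  also have "\<dots> = (\<Sum>x\<in>?U. \<Sum>F\<in>?A. of_bool (EM_eps I X x \<in> cofacets I F))"
    by (intro sum.cong refl) (simp add: of_bool_def finite_cofacets[OF I])
  also have "\<dots> = (\<Sum>x\<in>?U. card {F \<in> faces I. fdim F \<le> label_bound I 1 \<and> EM_eps I X x \<in> cofacets I F})"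
    using A by (intro sum.cong refl) (simp add: Int_def conj_assoc)
  also have "\<dots> = (\<Sum>x\<in>?U. min (fdeg I X x) (card I - fdeg I X x))"
    by (intro sum.cong refl) (simp only: card_faces_with_cofacet_eps[OF I] card_EM_eps[OF I])
  finally show ?thesis .
qed

text \<open>With \<open>l = n - k\<close>, the left side is \<open>k * (k - 1) + l * k\<close> for
  \<open>k < l\<close>, \<open>2 * k * (k - 1) + k\<close> for \<open>k = l\<close>, and
  \<open>k * l + l * (l - 1)\<close> for \<open>l < k\<close>. Truncated subtraction at
  \<open>k = 0\<close> or \<open>l = 0\<close> is harmless, as the factor in front vanishes.\<close>

lemma min_degree_deletion:
  fixes k n :: nat
  assumes "k \<le> n" "n \<ge> 1"
  shows "k * min (k - 1) (n - k) + (n - k) * min k (n - 1 - k) + (if 2 * k = n then k else 0)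
    = (n - 1) * min k (n - k)"
proof -
  obtain l where n: "n = k + l" using assms(1) le_Suc_ex by blast
  consider "k < l" | "k = l" | "l < k" by linarith
  then show ?thesis
  proof cases
    case 1
    then obtain m where "l = Suc (k + m)" using less_imp_Suc_add by blast
    then show ?thesis unfolding n by (cases k) (auto simp: algebra_simps)
  next
    case 2
    then show ?thesis using assms unfolding n by (cases k) (auto simp: algebra_simps)
  next
    case 3
    then obtain m where "k = Suc (l + m)" using less_imp_Suc_add by blast
    then show ?thesis unfolding n by (cases l) (auto simp: algebra_simps)
  qed
qed

lemma sum_min_degree_remove:
  assumes I: "finite I" "I \<noteq> {}"
  shows "(\<Sum>i\<in>I. min (fdeg (I - {i}) X x) (card (I - {i}) - fdeg (I - {i}) X x))
      + (if 2 * fdeg I X x = card I then fdeg I X x else 0)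
    = (card I - 1) * min (fdeg I X x) (card I - fdeg I X x)"
proof -
  let ?k = "fdeg I X x" and ?n = "card I"
  have n: "?n \<ge> 1" using I by (simp add: Suc_leI card_gt_0_iff)
  have k: "?k \<le> ?n" using I(1) by (rule fdeg_le_card)
  have "(\<Sum>i\<in>I. min (fdeg (I - {i}) X x) (card (I - {i}) - fdeg (I - {i}) X x))
      = (\<Sum>i\<in>I. if x \<in> X i then min (?k - 1) (?n - 1 - (?k - 1)) else min ?k (?n - 1 - ?k))"
    using I by (intro sum.cong refl) (simp add: fdeg_remove)
  also have "\<dots> = ?k * min (?k - 1) (?n - 1 - (?k - 1)) + (?n - ?k) * min ?k (?n - 1 - ?k)"
    using card_not_mem[OF I(1), of x X] I(1)
    by (simp add: sum.If_cases fdeg_def Int_def)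
  also have "?k * min (?k - 1) (?n - 1 - (?k - 1)) = ?k * min (?k - 1) (?n - ?k)"
    by (cases "?k = 0") auto
  finally show ?thesis using min_degree_deletion[OF k n] by simp
qed

lemma EM_SA_plus_Med:
  assumes I: "finite I" "I \<noteq> {}" and X: "\<And>i. i \<in> I \<Longrightarrow> finite (X i)"
  shows "2 * EM_SA I X + card I * card (EM_Med I X) = 2 * (card I - 1) * EM_Vol I X"
proof -
  let ?U = "family_union I X"
  have U: "finite ?U" using I X by (auto simp: family_union_def)
  have "EM_Vol (I - {i}) X
      = (\<Sum>x\<in>?U. min (fdeg (I - {i}) X x) (card (I - {i}) - fdeg (I - {i}) X x))"
    if "i \<in> I" for i
  proof -
    have "EM_Vol (I - {i}) X = (\<Sum>x\<in>family_union (I - {i}) X.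
        min (fdeg (I - {i}) X x) (card (I - {i}) - fdeg (I - {i}) X x))"
      using I X by (intro EM_Vol_eq_sum) auto
    also have "\<dots> = (\<Sum>x\<in>?U. min (fdeg (I - {i}) X x) (card (I - {i}) - fdeg (I - {i}) X x))"
      \<comment> \<open>Points lying in \<open>X i\<close> alone have degree 0 in the subfamily and
        contribute nothing, so all facets can be summed over the same set \<open>?U\<close>.\<close>
      by (rule sum.mono_neutral_left[OF U]) (auto simp: fdeg_eq_0, auto simp: family_union_def)
    finally show ?thesis .
  qed
  then have SA: "EM_SA I X = (\<Sum>x\<in>?U. \<Sum>i\<in>I.
      min (fdeg (I - {i}) X x) (card (I - {i}) - fdeg (I - {i}) X x))"
    unfolding EM_SA_def by (subst sum.swap) simp
  have "EM_Med I X = {x \<in> ?U. 2 * fdeg I X x = card I}"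
    by (auto simp: EM_Med_iff)
  then have "card I * card (EM_Med I X) = (\<Sum>x\<in>?U. if 2 * fdeg I X x = card I then card I else 0)"
    using U by (simp add: sum.If_cases Int_def)
  \<comment> \<open>The doubled shortfall \<open>2 * k\<close> of a median point is exactly
    \<open>card I\<close>.\<close>
  also have "\<dots> = 2 * (\<Sum>x\<in>?U. if 2 * fdeg I X x = card I then fdeg I X x else 0)"
    unfolding sum_distrib_left by (intro sum.cong) auto
  finally have "2 * EM_SA I X + card I * card (EM_Med I X)
      = 2 * (\<Sum>x\<in>?U. (card I - 1) * min (fdeg I X x) (card I - fdeg I X x))"
    unfolding SA sum_min_degree_remove[OF I, symmetric] sum.distrib by (simp only: distrib_left)
  then show ?thesis
    using EM_Vol_eq_sum[OF I(1) X] by (simp add: sum_distrib_left[symmetric])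
qed

theorem theorem4p3:
  fixes d :: nat and X :: "nat \<Rightarrow> 'a set"
  assumes "d \<ge> 1"
    and "\<And>i. i \<le> d \<Longrightarrow> finite (X i)"
  shows "real (EM_Vol {0..d} X) =
    1 / real d * (real (EM_SA {0..d} X) + (real d + 1) / 2 * real (card (EM_Med {0..d} X)))"
proof -
  \<comment> \<open>Here \<open>card {0..d} = d + 1\<close>, so the factor \<open>card I - 1\<close>
    is \<open>d\<close>.\<close>
  have "2 * EM_SA {0..d} X + (d + 1) * card (EM_Med {0..d} X) = 2 * d * EM_Vol {0..d} X"
    using EM_SA_plus_Med[of "{0..d}" X] assms(2) by simp
  then have "real (2 * EM_SA {0..d} X + (d + 1) * card (EM_Med {0..d} X))
      = real (2 * d * EM_Vol {0..d} X)"
    by (simp only:)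
  then show ?thesis
    using assms(1) by (simp add: field_simps)
qed

end
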